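(* Let $\lambda$ be a real number and let $n\ge k\ge 0$ be integers. Then $$S_\lambda(n,k)=B_{n,k}\big(0!,\,1!\lambda,\,2!\lambda^2,\,\dots,\,(n-k)!\,\lambda^{n-k}\big),$$ with the convention $\lambda^0=1$.
   Context: For real $\lambda$, $\langle x\rangle_{0,\lambda}=1$ and $\langle x\rangle_{n,\lambda}=x(x+\lambda)\cdots(x+(n-1)\lambda)$ for $n\ge1$; the unsigned degenerate Stirling numbers of the first kind $S_\lambda(n,k)$ are defined by $\langle x\rangle_{n,\lambda}=\sum_{k=0}^n S_\lambda(n,k)x^k$. The exponential partial Bell polynomials $B_{n,k}$ are defined by $\frac{1}{k!}\big(\sum_{m\ge1}x_m\frac{t^m}{m!}\big)^k=\sum_{n\ge k}B_{n,k}(x_1,\dots,x_{n-k+1})\frac{t^n}{n!}$ for $k\ge0$; explicitly $B_{n,k}(x_1,\dots,x_{n-k+1})=\sum \frac{n!}{i_1!\cdots i_{n-k+1}!}\prod_{j}\big(\frac{x_j}{j!}\big)^{i_j}$, the sum over nonnegative integers with $\sum_j i_j=k$ and $\sum_j j\,i_j=n$. *)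

theory Defs
  imports Complex_Main "HOL-Computational_Algebra.Computational_Algebra"
begin

definition deg_rising :: "real \<Rightarrow> nat \<Rightarrow> real \<Rightarrow> real" where
  "deg_rising l n x = (\<Prod>i<n. x + of_nat i * l)"

definition deg_rising_poly :: "real \<Rightarrow> nat \<Rightarrow> real poly" where
  "deg_rising_poly l n = (\<Prod>i<n. [:of_nat i * l, 1:])"

definition deg_stirling1 :: "real \<Rightarrow> nat \<Rightarrow> nat \<Rightarrow> real" where
  "deg_stirling1 l n k = coeff (deg_rising_poly l n) k"

lemma poly_deg_rising_poly: "poly (deg_rising_poly l n) x = deg_rising l n x"
  by (simp add: deg_rising_poly_def deg_rising_def poly_prod add.commute)

lemma degree_deg_rising_poly: "degree (deg_rising_poly l n) = n"
  unfolding deg_rising_poly_def by (subst degree_prod_eq_sum_degree) auto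

lemma deg_rising_expansion:
  "deg_rising l n x = (\<Sum>k\<le>n. deg_stirling1 l n k * x ^ k)"
  by (simp add: poly_altdef degree_deg_rising_poly deg_stirling1_def
      flip: poly_deg_rising_poly)

lemma deg_stirling1_unique:
  assumes "\<And>x. deg_rising l n x = (\<Sum>k\<le>n. c k * x ^ k)" and "k \<le> n"
  shows "deg_stirling1 l n k = c k"
proof -
  have "poly (\<Sum>k\<le>n. monom (c k) k) = poly (deg_rising_poly l n)"
    unfolding poly_deg_rising_poly assms(1) fun_eq_iff by (simp add: poly_sum poly_monom)
  then have "deg_rising_poly l n = (\<Sum>k\<le>n. monom (c k) k)"
    by (simp add: poly_eq_poly_eq_iff)
  then show ?thesis
    using assms(2) by (simp add: deg_stirling1_def coeff_sum)
qed

text \<open>A sequence \<open>x\<close> supplies the variables \<open>x 1, x 2, \<dots>\<close>; the value \<open>x 0\<close> is never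
  used, and by \<open>partial_Bell_cong\<close> only \<open>x 1, \<dots>, x (n - k + 1)\<close> matter for \<open>n \<ge> k\<close>.\<close>

definition egf1 :: "(nat \<Rightarrow> 'a::field_char_0) \<Rightarrow> 'a fps" where
  "egf1 x = Abs_fps (\<lambda>m. if m = 0 then 0 else x m / fact m)"

definition partial_Bell :: "nat \<Rightarrow> nat \<Rightarrow> (nat \<Rightarrow> 'a::field_char_0) \<Rightarrow> 'a" where
  "partial_Bell n k x = fact n * fps_nth (fps_const (1 / fact k) * egf1 x ^ k) n"

lemma partial_Bell_gf:
  "fps_const (1 / fact k) * egf1 x ^ k =
     Abs_fps (\<lambda>n. if n \<ge> k then partial_Bell n k x / fact n else 0)"
proof (rule fps_ext)
  fix n
  have "fps_nth (egf1 x ^ k) n = 0" if "n < k"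
    using that startsby_zero_power_prefix[of "egf1 x" k] by (simp add: egf1_def)
  then show "fps_nth (fps_const (1 / fact k) * egf1 x ^ k) n =
      fps_nth (Abs_fps (\<lambda>n. if n \<ge> k then partial_Bell n k x / fact n else 0)) n"
    by (simp add: partial_Bell_def)
qed

lemma partial_Bell_cong:
  assumes "k \<le> n" and "\<And>j. 1 \<le> j \<Longrightarrow> j \<le> n - k + 1 \<Longrightarrow> x j = y j"
  shows "partial_Bell n k x = partial_Bell n k y"
proof -
  define G where "G = (\<lambda>z :: nat \<Rightarrow> 'a. Abs_fps (\<lambda>i. z (Suc i) / fact (Suc i)))"
  have split: "egf1 z = fps_X * G z" for z :: "nat \<Rightarrow> 'a"
    by (rule fps_ext) (simp add: egf1_def G_def del: fact_Suc)
  have nth: "fps_nth (egf1 z ^ k) n = fps_nth (G z ^ k) (n - k)" for z :: "nat \<Rightarrow> 'a"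
    using assms(1) by (simp add: split power_mult_distrib fps_X_power_mult_nth)
  have "fps_nth (G x ^ l) m = fps_nth (G y ^ l) m" if "m \<le> n - k" for l m
    using that
  proof (induction l arbitrary: m)
    case (Suc l)
    have "fps_nth (G x) i = fps_nth (G y) i" if "i \<le> n - k" for i
      using that assms(2) by (simp add: G_def)
    with Suc show ?case
      by (auto simp: fps_mult_nth intro!: sum.cong)
  qed simp
  then show ?thesis
    by (simp add: partial_Bell_def nth)
qed

end

theory Submission
  imports Defs
begin

text \<open>The series \<open>E(t) = \<Sum>m\<ge>1. l^(m-1) t^m / m\<close> satisfies \<open>(1 - l t) E' = 1\<close>, so
  \<open>(1 - l t) (E^(k+1)/(k+1)!)' = E^k/k!\<close>. Comparing coefficients, the Bell numbers obey
  \<open>B(n+1,k+1) = B(n,k) + n l B(n,k+1)\<close>. Multiplication of the degenerate rising factorial by its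
  last factor \<open>x + n l\<close> gives the same recurrence for the degenerate Stirling numbers.\<close>

lemma deg_stirling1_0: "deg_stirling1 l 0 k = (if k = 0 then 1 else 0)"
  by (simp add: deg_stirling1_def deg_rising_poly_def)

text \<open>The factor with index 0 is the bare variable, which kills the constant
  coefficient.\<close>

lemma deg_stirling1_Suc_0: "deg_stirling1 l (Suc n) 0 = 0"
  by (induction n) (simp_all add: deg_stirling1_def deg_rising_poly_def coeff_mult)

lemma deg_stirling1_Suc_Suc:
  "deg_stirling1 l (Suc n) (Suc k) =
    deg_stirling1 l n k + of_nat n * l * deg_stirling1 l n (Suc k)"
proof -
  have "deg_rising_poly l (Suc n) = [:of_nat n * l, 1:] * deg_rising_poly l n"
    by (simp add: deg_rising_poly_def mult.commute)
  then show ?thesis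
    by (simp add: deg_stirling1_def)
qed

lemma partial_Bell_0: "partial_Bell 0 k x = (if k = 0 then 1 else 0)"
  by (simp add: partial_Bell_def egf1_def fps_power_zeroth)

lemma partial_Bell_Suc_0: "partial_Bell (Suc n) 0 x = 0"
  by (simp add: partial_Bell_def)

text \<open>The coefficient of t^m in the series is l^(m-1)/m for m > 0, so termwise differentiation
  gives the geometric series in l t.\<close>

lemma fps_deriv_egf1_geometric:
  fixes l :: "'a::field_char_0"
  shows "(1 - fps_const l * fps_X) * fps_deriv (egf1 (\<lambda>j. fact (j - 1) * l ^ (j - 1))) = 1"
proof -
  have "fps_deriv (egf1 (\<lambda>j. fact (j - 1) * l ^ (j - 1))) = Abs_fps (\<lambda>n. l ^ n)"
    by (rule fps_ext) (simp add: egf1_def field_simps del: of_nat_Suc)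
  moreover have "(1 - fps_const l * fps_X) * Abs_fps (\<lambda>n. l ^ n) = 1"
    by (rule fps_ext) (simp add: left_diff_distrib mult.assoc power_eq_if)
  ultimately show ?thesis
    by simp
qed

lemma partial_Bell_geometric_Suc_Suc:
  fixes l :: "'a::field_char_0"
  defines "x \<equiv> \<lambda>j. fact (j - 1) * l ^ (j - 1)"
  shows "partial_Bell (Suc n) (Suc k) x =
    partial_Bell n k x + of_nat n * l * partial_Bell n (Suc k) x"
proof -
  define F where "F = (\<lambda>k. fps_const (1 / fact k) * egf1 x ^ k)"
  have "fps_deriv (F (Suc k)) = F k * fps_deriv (egf1 x)"
  proof -
    have "fps_deriv (F (Suc k)) = fps_const (1 / fact (Suc k)) *
        (fps_const (of_nat (Suc k)) * fps_deriv (egf1 x) * egf1 x ^ k)"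
      unfolding F_def by (simp only: fps_deriv_mult_const_left fps_deriv_power diff_Suc_1)
    also have "\<dots> = fps_const (1 / fact (Suc k) * of_nat (Suc k)) * egf1 x ^ k * fps_deriv (egf1 x)"
      by (simp only: fps_const_mult[symmetric] mult_ac)
    \<comment> \<open>The factor k+1 from the power rule lowers the factorial, turning the
      normalisation of \<open>F (Suc k)\<close> into that of \<open>F k\<close>.\<close>
    also have "1 / fact (Suc k) * of_nat (Suc k) = (1 / fact k :: 'a)"
      by (simp del: of_nat_Suc)
    finally show ?thesis
      by (simp only: F_def)
  qed
  then have "(1 - fps_const l * fps_X) * fps_deriv (F (Suc k)) = F k"
    using fps_deriv_egf1_geometric[of l, folded x_def]
    by (simp only: mult.left_commute[of _ "F k"] mult_1_right)
  then have "fps_nth (F k) n = fps_nth ((1 - fps_const l * fps_X) * fps_deriv (F (Suc k))) n"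
    by simp
  \<comment> \<open>Multiplication by \<open>fps_X\<close> undoes the index shift of the derivative;
    at n = 0 the second term vanishes on both sides.\<close>
  also have "\<dots> = of_nat (Suc n) * fps_nth (F (Suc k)) (Suc n) - l * of_nat n * fps_nth (F (Suc k)) n"
    by (cases n) (simp_all add: left_diff_distrib mult.assoc)
  finally have "of_nat (Suc n) * fps_nth (F (Suc k)) (Suc n) =
      fps_nth (F k) n + of_nat n * l * fps_nth (F (Suc k)) n"
    by (simp add: algebra_simps)
  \<comment> \<open>Scaling by n! makes the left factor (n+1)!, so every coefficient becomes a Bell
    number.\<close>
  then have "fact n * (of_nat (Suc n) * fps_nth (F (Suc k)) (Suc n)) =
      fact n * (fps_nth (F k) n + of_nat n * l * fps_nth (F (Suc k)) n)"
    by (rule arg_cong)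
  moreover have "partial_Bell m j x = fact m * fps_nth (F j) m" for m j
    by (simp only: partial_Bell_def F_def)
  ultimately show ?thesis
    by (simp add: algebra_simps)
qed

theorem theorem3:
  fixes l :: real and n k :: nat
  assumes "k \<le> n"
  shows "deg_stirling1 l n k = partial_Bell n k (\<lambda>j. fact (j - 1) * l ^ (j - 1))"
proof -
  \<comment> \<open>The recurrence for column k+1 also draws on column k, so the induction on n
    treats all k at once.\<close>
  have "deg_stirling1 l n k = partial_Bell n k (\<lambda>j. fact (j - 1) * l ^ (j - 1))" for k
  proof (induction n arbitrary: k)
    case 0
    show ?case
      by (simp only: deg_stirling1_0 partial_Bell_0)
  next
    case (Suc n)
    then show ?case
      by (cases k) (simp_all only: deg_stirling1_Suc_0 partial_Bell_Suc_0 deg_stirling1_Suc_Suc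
          partial_Bell_geometric_Suc_Suc)
  qed
  then show ?thesis .
qed

end
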